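(* $R(B_{4,4},S_4)=9$.
   Context: For graphs $G_1,G_2$, $R(G_1,G_2)$ is the least integer $N$ such that every red/blue edge-coloring of $K_N$ contains a red copy of $G_1$ or a blue copy of $G_2$. $S_4$ denotes the star with $4$ edges ($5$ vertices). $B_{4,4}$ denotes the bistar on $8$ vertices: two adjacent vertices each of degree $4$, and $6$ further vertices of degree $1$. *)

theory Defs
  imports Main
begin

text \<open>A graph is a pair of a vertex set and a set of edges; an edge of a simple graph is a
  two-element set of vertices.\<close>

type_synonym 'a graph = "'a set \<times> 'a set set"

abbreviation verts :: "'a graph \<Rightarrow> 'a set" where "verts \<equiv> fst"

abbreviation edges :: "'a graph \<Rightarrow> 'a set set" where "edges \<equiv> snd"

definition simple_graph :: "'a graph \<Rightarrow> bool" where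
  "simple_graph G \<longleftrightarrow> finite (verts G) \<and> (\<forall>e\<in>edges G. e \<subseteq> verts G \<and> card e = 2)"

definition degree :: "'a graph \<Rightarrow> 'a \<Rightarrow> nat" where
  "degree G v = card {e \<in> edges G. v \<in> e}"

text \<open>A copy is a subgraph isomorphic to the given graph, not necessarily an induced one.\<close>

definition contains_copy :: "'a graph \<Rightarrow> 'b graph \<Rightarrow> bool" where
  "contains_copy H G \<longleftrightarrow>
     (\<exists>f. inj_on f (verts G) \<and> f ` verts G \<subseteq> verts H \<and> (\<forall>e\<in>edges G. f ` e \<in> edges H))"

definition complete_graph :: "nat \<Rightarrow> nat graph" where
  "complete_graph N = ({..<N}, {e. e \<subseteq> {..<N} \<and> card e = 2})"

datatype colour = Red | Blue

definition colour_class :: "'a graph \<Rightarrow> ('a set \<Rightarrow> colour) \<Rightarrow> colour \<Rightarrow> 'a graph" where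
  "colour_class G c k = (verts G, {e \<in> edges G. c e = k})"

text \<open>The colouring assigns a colour to every set of vertices, but only its values on the edges
  of the complete graph matter.\<close>

definition ramsey_number :: "'a graph \<Rightarrow> 'b graph \<Rightarrow> nat" where
  "ramsey_number G1 G2 =
     (LEAST N. \<forall>c. contains_copy (colour_class (complete_graph N) c Red) G1 \<or>
                   contains_copy (colour_class (complete_graph N) c Blue) G2)"

text \<open>The star with \<open>n\<close> edges, centred at \<open>0\<close>.\<close>

definition star :: "nat \<Rightarrow> nat graph" where
  "star n = ({0..n}, {{0, i} | i. i \<in> {1..n}})"

text \<open>The bistar on \<open>m + n\<close> vertices (\<open>m, n \<ge> 1\<close>): the subscripts are the degrees of the two
  adjacent centres \<open>0\<close> and \<open>1\<close>, which therefore carry \<open>m - 1\<close> and \<open>n - 1\<close> leaves.\<close>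

definition bistar :: "nat \<Rightarrow> nat \<Rightarrow> nat graph" where
  "bistar m n = ({0..<m + n},
     {{0, 1}} \<union> {{0, i} | i. i \<in> {2..<m + 1}} \<union> {{1, j} | j. j \<in> {m + 1..<m + n}})"

lemma edges_star_4: "edges (star 4) = {{0, 1}, {0, 2}, {0, 3}, {0, 4}}"
proof -
  have "{1..4::nat} = {1, 2, 3, 4}" by auto
  then show ?thesis unfolding star_def by auto
qed

lemma edges_bistar_4_4:
  "edges (bistar 4 4) = {{0, 1}, {0, 2}, {0, 3}, {0, 4}, {1, 5}, {1, 6}, {1, 7}}"
proof -
  have "{2..<4 + 1::nat} = {2, 3, 4}" "{4 + 1..<4 + 4::nat} = {5, 6, 7}" by auto
  then show ?thesis unfolding bistar_def by auto
qed

lemma simple_graph_star_4: "simple_graph (star 4)"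
  unfolding simple_graph_def edges_star_4 by (auto simp: star_def)

lemma simple_graph_bistar_4_4: "simple_graph (bistar 4 4)"
  unfolding simple_graph_def edges_bistar_4_4 by (auto simp: bistar_def)

lemma degree_bistar_4_4:
  "degree (bistar 4 4) 0 = 4" "degree (bistar 4 4) 1 = 4"
  "v \<in> {2..<8} \<Longrightarrow> degree (bistar 4 4) v = 1"
proof -
  have *: "degree (bistar 4 4) v = card (Set.filter (\<lambda>e. v \<in> e)
      {{0, 1}, {0, 2}, {0, 3}, {0, 4}, {1, 5}, {1, 6}, {1, 7}})" for v
    unfolding degree_def edges_bistar_4_4 by (rule arg_cong[where f = card]) auto
  have ins: "Set.filter P (insert x A) = (if P x then insert x (Set.filter P A) else Set.filter P A)"
    for P :: "nat set \<Rightarrow> bool" and x A by auto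
  have emp: "Set.filter P {} = {}" for P :: "nat set \<Rightarrow> bool" by auto
  show "degree (bistar 4 4) 0 = 4" "degree (bistar 4 4) 1 = 4"
    unfolding * ins emp by (simp_all add: doubleton_eq_iff)
  assume "v \<in> {2..<8}"
  then have "v = 2 \<or> v = 3 \<or> v = 4 \<or> v = 5 \<or> v = 6 \<or> v = 7" by auto
  then show "degree (bistar 4 4) v = 1"
    unfolding * ins emp by (elim disjE) simp_all
qed

end

theory Submission
  imports Defs
begin

text \<open>Upper bound: without a blue \<open>S\<^sub>4\<close> every red degree in \<open>K\<^sub>9\<close> is at least \<open>5\<close>, and by parity
  some vertex \<open>u\<close> has red degree at least \<open>6\<close>. A red edge \<open>uv\<close> extends to a bistar as soon as
  the two centres together see \<open>6\<close> further vertices. This is automatic if \<open>u\<close> has degree at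
  least \<open>7\<close>. If it has degree \<open>6\<close>, take a vertex \<open>w\<close> not adjacent to \<open>u\<close>; it has a common
  neighbour \<open>v\<close> with \<open>u\<close>, and \<open>w\<close> is the missing sixth vertex.

  Lower bound: the circulant graph on \<open>\<int>/8\<close> with differences \<open>\<plusminus>1, \<plusminus>2\<close> is \<open>4\<close>-regular and each of its
  edges lies in a triangle, so the centres of a bistar would see at most \<open>5\<close> further vertices; its
  complement is \<open>3\<close>-regular.\<close>

section \<open>Neighbourhoods, and copies of stars and bistars expressed through them\<close>

definition nbhd :: "'a graph \<Rightarrow> 'a \<Rightarrow> 'a set" where
  "nbhd G v = {w. {v, w} \<in> edges G}"

lemma nbhd_sym: "w \<in> nbhd G v \<longleftrightarrow> v \<in> nbhd G w"
  by (simp add: nbhd_def insert_commute)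

lemma nbhd_subset: "simple_graph G \<Longrightarrow> nbhd G v \<subseteq> verts G - {v}"
  by (force simp: simple_graph_def nbhd_def)

lemma finite_nbhd: "simple_graph G \<Longrightarrow> finite (nbhd G v)"
  using nbhd_subset[of G v] by (auto simp: simple_graph_def intro: finite_subset)

text \<open>The same embedding serves both graphs. This transfers a copy from a smaller complete
  graph to the one on 8 vertices, so that a single colouring refutes every \<open>N\<close> below
  9.\<close>

lemma contains_copy_mono:
  assumes "contains_copy H G" "verts H \<subseteq> verts H'" "edges H \<subseteq> edges H'"
  shows "contains_copy H' G"
proof -
  obtain f where "inj_on f (verts G)" "f ` verts G \<subseteq> verts H" "\<forall>e\<in>edges G. f ` e \<in> edges H"
    using assms(1) unfolding contains_copy_def by blast
  then show ?thesis
    using assms(2,3) unfolding contains_copy_def by (intro exI[of _ f]) auto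
qed

text \<open>The leaves of a copy are \<open>n\<close> distinct neighbours of the image of
  \<open>0\<close>, and any \<open>n\<close> neighbours of a vertex can serve as leaves. Letting
  \<open>v\<close> range over \<open>verts H\<close> keeps the case \<open>n = 0\<close>
  correct.\<close>

lemma contains_copy_star_iff:
  assumes "simple_graph H"
  shows "contains_copy H (star n) \<longleftrightarrow> (\<exists>v\<in>verts H. n \<le> card (nbhd H v))"
proof
  assume "contains_copy H (star n)"
  then obtain f where f: "inj_on f {0..n}" "f ` {0..n} \<subseteq> verts H"
    "\<forall>e \<in> {{0, i} | i. i \<in> {1..n}}. f ` e \<in> edges H"
    unfolding contains_copy_def star_def fst_conv snd_conv by blast
  have "f ` {1..n} \<subseteq> nbhd H (f 0)"
  proof -
    have "f ` {0, i} \<in> edges H" if "i \<in> {1..n}" for i using f(3) that by blast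
    then show ?thesis by (simp add: nbhd_def image_subset_iff)
  qed
  then have "card (f ` {1..n}) \<le> card (nbhd H (f 0))"
    using assms by (intro card_mono finite_nbhd)
  moreover have "card (f ` {1..n}) = n"
    using f(1) by (subst card_image) (auto simp: inj_on_def)
  ultimately show "\<exists>v\<in>verts H. n \<le> card (nbhd H v)"
    using f(2) by (intro bexI[of _ "f 0"]) auto
next
  assume "\<exists>v\<in>verts H. n \<le> card (nbhd H v)"
  then obtain v T where v: "v \<in> verts H" and T: "T \<subseteq> nbhd H v" "card T = n" "finite T"
    by (meson obtain_subset_with_card_n)
  obtain h where h: "bij_betw h {1..n} T"
    using ex_bij_betw_nat_finite_1[OF T(3)] T(2) by auto
  define f where "f = h(0 := v)"
  have f0: "bij_betw f {0} {v}"
    by (simp add: bij_betw_def f_def)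
  have fT: "bij_betw f {1..n} T"
    using h by (subst bij_betw_cong[where g = h]) (auto simp: f_def)
  have T': "T \<subseteq> verts H - {v}"
    using T(1) nbhd_subset[OF assms] by blast
  have V: "{0..n} = {0} \<union> {1..n}" by auto
  have "bij_betw f ({0} \<union> {1..n}) ({v} \<union> T)"
    by (intro bij_betw_combine f0 fT) (use T' in auto)
  then have inj: "inj_on f {0..n}" and ran: "f ` {0..n} \<subseteq> verts H"
    unfolding V using T' v by (auto simp: bij_betw_def)
  \<comment> \<open>Only the value of \<open>f\<close> at \<open>0\<close> is unfolded below;
    \<open>f i\<close> stays opaque so that its membership in \<open>T\<close> applies.\<close>
  have "f ` {0, i} \<in> edges H" if "i \<in> {1..n}" for i
    using bij_betwE[OF fT, rule_format, OF that] T(1)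
    by (auto simp: nbhd_def f_def[THEN fun_cong, of 0])
  then have "\<forall>e\<in>{{0, i} | i. i \<in> {1..n}}. f ` e \<in> edges H"
    by blast
  with inj ran show "contains_copy H (star n)"
    unfolding contains_copy_def star_def fst_conv snd_conv by (intro exI[of _ f] conjI)
qed

text \<open>\<open>A\<close> and \<open>B\<close> are the images of the two blocks of leaves. Copies
  need not be induced, so \<open>A\<close> may meet the neighbourhood of \<open>v\<close>, and
  \<open>B\<close> that of \<open>u\<close>; only disjointness matters.\<close>

lemma contains_copy_bistar_iff:
  assumes "simple_graph H" "m \<ge> 1" "n \<ge> 1"
  shows "contains_copy H (bistar m n) \<longleftrightarrow>
    (\<exists>u v A B. v \<in> nbhd H u \<and> A \<subseteq> nbhd H u - {v} \<and> B \<subseteq> nbhd H v - {u} \<and> A \<inter> B = {} \<and>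
       card A = m - 1 \<and> card B = n - 1)"
proof
  have V: "{0..<m+n} = {0, 1} \<union> {2..<m+1} \<union> {m+1..<m+n}"
    using assms by auto
  assume "contains_copy H (bistar m n)"
  then obtain f where f: "inj_on f {0..<m+n}" and e: "\<forall>e \<in> {{0, 1}} \<union>
      {{0, i} | i. i \<in> {2..<m + 1}} \<union> {{1, j} | j. j \<in> {m + 1..<m + n}}. f ` e \<in> edges H"
    unfolding contains_copy_def bistar_def fst_conv snd_conv by blast
  let ?A = "f ` {2..<m+1}" and ?B = "f ` {m+1..<m+n}"
  have inj: "inj_on f {2..<m+1}" "inj_on f {m+1..<m+n}"
    by (rule inj_on_subset[OF f]; use V in blast)+
  have "card ?A = m - 1" "card ?B = n - 1"
    using inj by (auto simp: card_image)
  moreover have "?A \<inter> ?B = {}"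
    using inj_on_image_Int[OF f, of "{2..<m+1}" "{m+1..<m+n}"] V by auto
  moreover have "f 1 \<notin> ?A"
    using inj_on_image_mem_iff[OF f, of 1 "{2..<m+1}"] V by auto
  moreover have "f 0 \<notin> ?B"
    using inj_on_image_mem_iff[OF f, of 0 "{m+1..<m+n}"] V by auto
  moreover have "?A \<subseteq> nbhd H (f 0)" "?B \<subseteq> nbhd H (f 1)" "f 1 \<in> nbhd H (f 0)"
  proof -
    have "f ` {0, i} \<in> edges H" if "i \<in> {2..<m+1}" for i using e that by blast
    moreover have "f ` {1, i} \<in> edges H" if "i \<in> {m+1..<m+n}" for i using e that by blast
    moreover have "f ` {0, 1} \<in> edges H" using e by blast
    ultimately show "?A \<subseteq> nbhd H (f 0)" "?B \<subseteq> nbhd H (f 1)" "f 1 \<in> nbhd H (f 0)"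
      by (simp_all add: nbhd_def image_subset_iff)
  qed
  ultimately show "\<exists>u v A B. v \<in> nbhd H u \<and> A \<subseteq> nbhd H u - {v} \<and> B \<subseteq> nbhd H v - {u} \<and>
      A \<inter> B = {} \<and> card A = m - 1 \<and> card B = n - 1"
    by (metis subset_Diff_insert Diff_empty)
next
  assume "\<exists>u v A B. v \<in> nbhd H u \<and> A \<subseteq> nbhd H u - {v} \<and> B \<subseteq> nbhd H v - {u} \<and> A \<inter> B = {} \<and>
       card A = m - 1 \<and> card B = n - 1"
  then obtain u v A B where uv: "v \<in> nbhd H u" and A: "A \<subseteq> nbhd H u - {v}" "card A = m - 1"
    and B: "B \<subseteq> nbhd H v - {u}" "card B = n - 1" and AB: "A \<inter> B = {}"
    by blast
  have V: "{0..<m+n} = {0} \<union> {1} \<union> {2..<m+1} \<union> {m+1..<m+n}"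
    using assms by auto
  have "finite A" "finite B"
    using A(1) B(1) finite_nbhd[OF assms(1)] by (meson finite_Diff finite_subset)+
  then obtain g h where g: "bij_betw g {2..<m+1} A" and h: "bij_betw h {m+1..<m+n} B"
    using finite_same_card_bij[of "{2..<m+1}" A] finite_same_card_bij[of "{m+1..<m+n}" B] A(2) B(2)
    by auto
  define f where "f = (\<lambda>i. if i = 0 then u else if i = 1 then v else if i < m + 1 then g i else h i)"
  have f01: "bij_betw f {0} {u}" "bij_betw f {1} {v}"
    by (auto simp: bij_betw_def f_def)
  have fA: "bij_betw f {2..<m+1} A"
    using g by (subst bij_betw_cong[where g = g]) (auto simp: f_def)
  have fB: "bij_betw f {m+1..<m+n} B"
    using h assms(2) by (subst bij_betw_cong[where g = h]) (auto simp: f_def)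
  have AB': "A \<subseteq> verts H - {u} - {v}" "B \<subseteq> verts H - {u} - {v}"
    using A(1) B(1) nbhd_subset[OF assms(1)] by blast+
  have uv': "u \<noteq> v" "u \<in> verts H" "v \<in> verts H"
    using uv nbhd_sym[of v H u] nbhd_subset[OF assms(1)] by blast+
  have "bij_betw f ({0} \<union> {1} \<union> {2..<m+1} \<union> {m+1..<m+n}) ({u} \<union> {v} \<union> A \<union> B)"
    by (intro bij_betw_combine f01 fA fB) (use AB' uv' AB in auto)
  then have inj: "inj_on f {0..<m+n}" and ran: "f ` {0..<m+n} \<subseteq> verts H"
    unfolding V using AB' uv' by (auto simp: bij_betw_def)
  have "f ` {0, i} \<in> edges H" if "i \<in> {2..<m+1}" for i
    using bij_betwE[OF fA, rule_format, OF that] A(1) by (auto simp: nbhd_def f_def[THEN fun_cong, of 0])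
  moreover have "f ` {1, i} \<in> edges H" if "i \<in> {m+1..<m+n}" for i
    using bij_betwE[OF fB, rule_format, OF that] B(1) by (auto simp: nbhd_def f_def[THEN fun_cong, of "Suc 0"])
  moreover have "f ` {0, 1} \<in> edges H"
    using uv by (simp add: nbhd_def f_def insert_commute)
  ultimately have "\<forall>e\<in>{{0, 1}} \<union> {{0, i} | i. i \<in> {2..<m+1}} \<union>
      {{1, j} | j. j \<in> {m+1..<m+n}}. f ` e \<in> edges H"
    by blast
  with inj ran show "contains_copy H (bistar m n)"
    unfolding contains_copy_def bistar_def fst_conv snd_conv by (intro exI[of _ f] conjI)
qed

section \<open>Disjoint choices of leaves and parity of the degree sum\<close>

text \<open>Hall's condition for two sets. If \<open>X - Y\<close> has room for \<open>A\<close>,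
  any \<open>B\<close> inside \<open>Y\<close> avoids it. Otherwise \<open>A\<close> is made to
  swallow all of \<open>X - Y\<close>, so \<open>Y - A\<close> has
  \<open>card (X \<union> Y) - a\<close> elements, which is at least \<open>b\<close>.\<close>

lemma disjoint_subsets_with_cards:
  assumes "finite X" "finite Y" "a \<le> card X" "b \<le> card Y" "a + b \<le> card (X \<union> Y)"
  obtains A B where "A \<subseteq> X" "B \<subseteq> Y" "A \<inter> B = {}" "card A = a" "card B = b"
proof (cases "a \<le> card (X - Y)")
  case True
  then obtain A where "A \<subseteq> X - Y" "card A = a"
    by (meson obtain_subset_with_card_n)
  moreover obtain B where "B \<subseteq> Y" "card B = b"
    using assms(4) by (meson obtain_subset_with_card_n)
  ultimately show ?thesis using that by blast
next
  case False
  then obtain A where A: "X - Y \<subseteq> A" "A \<subseteq> X" "card A = a"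
    using exists_subset_between[of "X - Y" a X] assms(1,3) by auto
  have "card (X \<union> Y) = card (A \<union> (Y - A))"
    using A by (intro arg_cong[where f = card]) blast
  also have "\<dots> = a + card (Y - A)"
    using A assms(1,2) by (subst card_Un_disjoint) (auto intro: finite_subset)
  finally have "b \<le> card (Y - A)" using assms(5) by simp
  then obtain B where "B \<subseteq> Y - A" "card B = b"
    by (meson obtain_subset_with_card_n)
  then show ?thesis using A that by blast
qed

text \<open>The degree sum counts ordered pairs of adjacent vertices. Swapping matches the
  increasing pairs with the decreasing ones; the linear order serves only to tell these
  apart.\<close>

lemma handshake:
  fixes G :: "'a::linorder graph"
  assumes "simple_graph G"
  shows "even (\<Sum>v\<in>verts G. card (nbhd G v))"
proof -
  let ?S = "SIGMA v:verts G. nbhd G v"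
  let ?L = "{p \<in> ?S. fst p < snd p}" and ?R = "{p \<in> ?S. snd p < fst p}"
  have fin: "finite ?S"
    using assms finite_nbhd[OF assms] by (auto simp: simple_graph_def)
  have "?R = prod.swap ` ?L"
  proof -
    have "w \<in> nbhd G v \<Longrightarrow> v \<in> nbhd G w \<and> w \<in> verts G" for v w
      using nbhd_sym[of w G v] nbhd_subset[OF assms, of v] by blast
    then show ?thesis by (force simp: image_iff)
  qed
  then have "card ?R = card ?L"
    by (simp add: card_image)
  moreover have "?S = ?L \<union> ?R"
  proof -
    have "v \<notin> nbhd G v" for v
      using nbhd_subset[OF assms, of v] by blast
    then show ?thesis by (auto simp: not_less_iff_gr_or_eq)
  qed
  moreover have "card (?L \<union> ?R) = card ?L + card ?R"
    using fin by (intro card_Un_disjoint) auto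
  ultimately have "card ?S = 2 * card ?L" by simp
  moreover have "card ?S = (\<Sum>v\<in>verts G. card (nbhd G v))"
    using assms finite_nbhd[OF assms] by (subst card_SigmaI) (auto simp: simple_graph_def)
  ultimately show ?thesis by (metis dvd_triv_left)
qed

section \<open>Upper bound\<close>

lemma bistar_4_4_of_min_degree_5:
  fixes G :: "'a::linorder graph"
  assumes G: "simple_graph G" "card (verts G) = 9"
    and deg: "\<And>v. v \<in> verts G \<Longrightarrow> 5 \<le> card (nbhd G v)"
  shows "contains_copy G (bistar 4 4)"
proof -
  \<comment> \<open>Each centre has at least 4 neighbours besides the other one, so of the
    conditions for choosing 3 + 3 disjoint leaves only the size of the union remains to be
    checked.\<close>
  have copy: ?thesis if uv: "v \<in> nbhd G u" and un: "6 \<le> card (nbhd G u - {v} \<union> (nbhd G v - {u}))"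
    for u v
  proof -
    have vu: "u \<in> nbhd G v" using uv nbhd_sym by metis
    have "u \<in> verts G" "v \<in> verts G"
      using uv vu nbhd_subset[OF G(1)] by blast+
    then have "3 \<le> card (nbhd G u - {v})" "3 \<le> card (nbhd G v - {u})"
      using deg[of u] deg[of v] uv vu by simp_all
    then obtain A B where "A \<subseteq> nbhd G u - {v}" "B \<subseteq> nbhd G v - {u}" "A \<inter> B = {}"
      "card A = 3" "card B = 3"
      using disjoint_subsets_with_cards[of "nbhd G u - {v}" "nbhd G v - {u}" 3 3] un
        finite_nbhd[OF G(1)] by auto
    then show ?thesis
      using uv by (subst contains_copy_bistar_iff[OF G(1)]) auto
  qed
  \<comment> \<open>Otherwise all nine degrees equal 5 and sum to 45, which is odd.\<close>
  have "\<exists>u\<in>verts G. 6 \<le> card (nbhd G u)"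
  proof (rule ccontr)
    assume "\<not> ?thesis"
    then have "card (nbhd G v) = 5" if "v \<in> verts G" for v
      using deg[OF that] that by fastforce
    then have "(\<Sum>v\<in>verts G. card (nbhd G v)) = 45" using G(2) by simp
    then show False using handshake[OF G(1)] by simp
  qed
  then obtain u where u: "u \<in> verts G" "6 \<le> card (nbhd G u)" by blast
  have fin: "finite (verts G)" using G(1) by (simp add: simple_graph_def)
  show ?thesis
  proof (cases "card (nbhd G u) = 6")
    case False
    then obtain v where v: "v \<in> nbhd G u" using u(2) by fastforce
    have "6 \<le> card (nbhd G u - {v})" using False u(2) v by simp
    also have "\<dots> \<le> card (nbhd G u - {v} \<union> (nbhd G v - {u}))"
      using finite_nbhd[OF G(1)] by (intro card_mono) auto
    finally show ?thesis using copy v by blast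
  next
    case True
    let ?W = "verts G - insert u (nbhd G u)"
    have W: "card ?W = 2"
      using True u(1) nbhd_subset[OF G(1), of u] G(2) finite_nbhd[OF G(1)]
      by (subst card_Diff_subset) (auto simp: card_insert_if)
    then obtain w where w: "w \<in> ?W" by (metis card_2_iff')
    \<comment> \<open>The two vertices of \<open>?W\<close> cannot hold the at least 5 neighbours of
      \<open>w\<close>, so one of these is adjacent to \<open>u\<close>.\<close>
    have "\<not> nbhd G w \<subseteq> ?W"
      using card_mono[of ?W "nbhd G w"] fin W deg[of w] w by auto
    moreover have "u \<notin> nbhd G w" using w nbhd_sym[of u G w] by auto
    ultimately obtain v where v: "v \<in> nbhd G w" "v \<in> nbhd G u"
      using nbhd_subset[OF G(1), of w] by blast
    have "w \<in> nbhd G v" using v(1) nbhd_sym by metis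
    then have sub: "insert w (nbhd G u - {v}) \<subseteq> nbhd G u - {v} \<union> (nbhd G v - {u})"
      using w by auto
    have "6 = card (insert w (nbhd G u - {v}))"
      using w v(2) True finite_nbhd[OF G(1)] by simp
    also have "\<dots> \<le> card (nbhd G u - {v} \<union> (nbhd G v - {u}))"
      using finite_nbhd[OF G(1)] by (intro card_mono sub) auto
    finally show ?thesis using copy v by blast
  qed
qed

section \<open>Colour classes of complete graphs\<close>

lemma simple_graph_colour_class_complete: "simple_graph (colour_class (complete_graph N) c k)"
  by (auto simp: simple_graph_def colour_class_def complete_graph_def)

lemma verts_colour_class_complete: "verts (colour_class (complete_graph N) c k) = {..<N}"
  by (simp add: colour_class_def complete_graph_def)

lemma nbhd_colour_class_complete:
  "nbhd (colour_class (complete_graph N) c k) v =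
     (if v < N then {w. w < N \<and> w \<noteq> v \<and> c {v, w} = k} else {})"
  by (auto simp: nbhd_def colour_class_def complete_graph_def card_insert_if)

text \<open>Red and blue degrees add up to 8 at every vertex, so blue degrees of at most 3 force red
  degrees of at least 5.\<close>

lemma ramsey_upper:
  "contains_copy (colour_class (complete_graph 9) c Red) (bistar 4 4) \<or>
   contains_copy (colour_class (complete_graph 9) c Blue) (star 4)"
proof (rule disjCI)
  let ?R = "colour_class (complete_graph 9) c Red" and ?B = "colour_class (complete_graph 9) c Blue"
  assume "\<not> contains_copy ?B (star 4)"
  then have blue: "card (nbhd ?B v) < 4" if "v < 9" for v
    using that by (auto simp: contains_copy_star_iff simple_graph_colour_class_complete
        verts_colour_class_complete not_le)
  have "5 \<le> card (nbhd ?R v)" if v: "v < 9" for v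
  proof -
    have "nbhd ?R v \<union> nbhd ?B v = {..<9} - {v}"
      using v colour.exhaust by (auto simp: nbhd_colour_class_complete)
    moreover have "card ({..<9} - {v}) = 8" using v by simp
    ultimately have "8 \<le> card (nbhd ?R v) + card (nbhd ?B v)"
      by (metis card_Un_le)
    then show ?thesis using blue[OF v] by simp
  qed
  then show "contains_copy ?R (bistar 4 4)"
    by (intro bistar_4_4_of_min_degree_5)
      (auto simp: simple_graph_colour_class_complete verts_colour_class_complete)
qed

section \<open>Lower bound\<close>

text \<open>Adding 8 keeps subtraction of vertices below 8 from truncating. The residues are closed
  under negation, so the order of \<open>x\<close> and \<open>y\<close> is immaterial, and they omit
  0, so \<open>x = y\<close> never makes a set red.\<close>

definition circulant_colouring :: "nat set \<Rightarrow> colour" where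
  "circulant_colouring e =
     (if \<exists>x\<in>e. \<exists>y\<in>e. (x + 8 - y) mod 8 \<in> {1, 2, 6, 7} then Red else Blue)"

lemma nbhd_circulant:
  defines "G \<equiv> \<lambda>k. colour_class (complete_graph 8) circulant_colouring k"
  assumes "v < 8"
  shows "nbhd (G Red) v = {(v + 1) mod 8, (v + 2) mod 8, (v + 6) mod 8, (v + 7) mod 8}"
    and "nbhd (G Blue) v = {(v + 3) mod 8, (v + 4) mod 8, (v + 5) mod 8}"
proof -
  have lt8: "x < 8 \<longleftrightarrow> x \<in> {0, 1, 2, 3, 4, 5, 6, 7}" for x :: nat by auto
  have v: "v \<in> {0, 1, 2, 3, 4, 5, 6, 7}" using assms by (simp add: lt8)
  have R: "w \<noteq> v \<and> circulant_colouring {v, w} = Red \<longleftrightarrow>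
      w \<in> {(v + 1) mod 8, (v + 2) mod 8, (v + 6) mod 8, (v + 7) mod 8}"
    and B: "w \<noteq> v \<and> circulant_colouring {v, w} = Blue \<longleftrightarrow>
      w \<in> {(v + 3) mod 8, (v + 4) mod 8, (v + 5) mod 8}" if "w < 8" for w
    \<comment> \<open>All 64 pairs of vertices are evaluated.\<close>
    using v that unfolding lt8 circulant_colouring_def
    by (elim insertE emptyE; simp)+
  have nbhd_k: "nbhd (G k) v = S"
    if "S \<subseteq> {..<8}" "\<And>w. w < 8 \<Longrightarrow> w \<noteq> v \<and> circulant_colouring {v, w} = k \<longleftrightarrow> w \<in> S" for k S
    using assms that by (auto simp: nbhd_colour_class_complete)
  show "nbhd (G Red) v = {(v + 1) mod 8, (v + 2) mod 8, (v + 6) mod 8, (v + 7) mod 8}"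
    by (rule nbhd_k[OF _ R]) auto
  show "nbhd (G Blue) v = {(v + 3) mod 8, (v + 4) mod 8, (v + 5) mod 8}"
    by (rule nbhd_k[OF _ B]) auto
qed

lemma circulant_lower:
  "\<not> contains_copy (colour_class (complete_graph 8) circulant_colouring Red) (bistar 4 4)"
  "\<not> contains_copy (colour_class (complete_graph 8) circulant_colouring Blue) (star 4)"
proof -
  let ?G = "colour_class (complete_graph 8) circulant_colouring"
  show "\<not> contains_copy (?G Blue) (star 4)"
  proof
    assume "contains_copy (?G Blue) (star 4)"
    then obtain v where v: "v < 8" "4 \<le> card (nbhd (?G Blue) v)"
      by (auto simp: contains_copy_star_iff simple_graph_colour_class_complete
          verts_colour_class_complete)
    have "card (nbhd (?G Blue) v) \<le> 3"
      unfolding nbhd_circulant(2)[OF v(1)] by (simp add: card_insert_if)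
    then show False using v(2) by simp
  qed
  show "\<not> contains_copy (?G Red) (bistar 4 4)"
  proof
    assume "contains_copy (?G Red) (bistar 4 4)"
    then obtain u v A B where uv: "v \<in> nbhd (?G Red) u"
      and A: "A \<subseteq> nbhd (?G Red) u - {v}" "card A = 3"
      and B: "B \<subseteq> nbhd (?G Red) v - {u}" "card B = 3" and AB: "A \<inter> B = {}"
      by (auto simp: contains_copy_bistar_iff simple_graph_colour_class_complete)
    have u: "u < 8" and v: "v < 8"
      using uv by (auto simp: nbhd_colour_class_complete split: if_splits)
    \<comment> \<open>Infinite sets have cardinality 0, so cardinality 3 already gives
      finiteness.\<close>
    have "finite A" "finite B"
      using A(2) B(2) by (auto intro: card_ge_0_finite)
    then have "6 = card (A \<union> B)"
      using A(2) B(2) AB by (simp add: card_Un_disjoint)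
    also have "\<dots> \<le> card (nbhd (?G Red) u - {v} \<union> (nbhd (?G Red) v - {u}))"
      using A(1) B(1) finite_nbhd[OF simple_graph_colour_class_complete]
      by (intro card_mono) (blast | simp)+
    \<comment> \<open>Each side contributes 3 vertices and some vertex is common to both. Every red
      edge is checked; equality occurs for the differences 2 and 6.\<close>
    also have "\<dots> \<le> 5"
    proof -
      have "u \<in> {0, 1, 2, 3, 4, 5, 6, 7}" using u by auto
      then show ?thesis
        using uv unfolding nbhd_circulant(1)[OF u] nbhd_circulant(1)[OF v]
        by (elim insertE emptyE) (simp_all add: insert_Diff_if card_insert_if)
    qed
    finally show False by simp
  qed
qed

theorem theorem6: "ramsey_number (bistar 4 4) (star 4) = 9"
  unfolding ramsey_number_def
proof (rule Least_equality)
  show "\<forall>c. contains_copy (colour_class (complete_graph 9) c Red) (bistar 4 4) \<or>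
      contains_copy (colour_class (complete_graph 9) c Blue) (star 4)"
    using ramsey_upper by blast
next
  fix N
  assume *: "\<forall>c. contains_copy (colour_class (complete_graph N) c Red) (bistar 4 4) \<or>
      contains_copy (colour_class (complete_graph N) c Blue) (star 4)"
  show "9 \<le> N"
  proof (rule ccontr)
    assume "\<not> 9 \<le> N"
    \<comment> \<open>A colouring is defined on all sets of vertices, so the same \<open>c\<close>
      colours both complete graphs and each colour class for \<open>N\<close> is a subgraph of the
      one for 8.\<close>
    then have "verts (colour_class (complete_graph N) c k) \<subseteq> verts (colour_class (complete_graph 8) c k)"
      "edges (colour_class (complete_graph N) c k) \<subseteq> edges (colour_class (complete_graph 8) c k)"
      for c k by (auto simp: colour_class_def complete_graph_def)
    then show False
      using * circulant_lower contains_copy_mono by metis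
  qed
qed

end
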